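(* Let $0\le k\le d$ be integers and let $0<\alpha\le 1$ be a real number. There exists a constant $\beta=\beta(\alpha,k,d)>0$, depending only on $\alpha,k,d$, such that the following holds. For every finite family $\mathcal{F}$ of at least $d-k+1$ closed convex sets in $\mathbb{R}^d$, if at least $\alpha\binom{|\mathcal{F}|}{d-k+1}$ of the $(d-k+1)$-element subfamilies of $\mathcal{F}$ have the property that their intersection contains a $k$-flat, then there exists $\mathcal{G}\subseteq\mathcal{F}$ such that $|\mathcal{G}|\ge\beta|\mathcal{F}|$ and $\bigcap\mathcal{G}$ contains a $k$-flat. Moreover, $\beta$ can be chosen so that $\beta\ge\frac{\alpha}{d-k+1}$.
   Context: A $k$-flat in $\mathbb{R}^d$ is a $k$-dimensional affine subspace (a $0$-flat is a point). $\bigcap\mathcal{G}$ denotes the intersection of all sets in the family $\mathcal{G}$. *)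

theory Defs
  imports "HOL-Analysis.Analysis"
begin

definition kflat :: "nat \<Rightarrow> 'a::euclidean_space set \<Rightarrow> bool" where
  "kflat k A \<longleftrightarrow> affine A \<and> aff_dim A = int k"
  \<comment> \<open>A flat is nonempty here, since \<open>aff_dim {} = -1\<close>.\<close>

definition contains_kflat :: "nat \<Rightarrow> 'a::euclidean_space set \<Rightarrow> bool" where
  "contains_kflat k X \<longleftrightarrow> (\<exists>A. kflat k A \<and> A \<subseteq> X)"

text \<open>
  The class \<open>euclidean_space\<close> has no zero-dimensional instance. To admit every dimension
  \<open>d \<ge> 0\<close>, the space \<open>\<real>\<^sup>d\<close> is represented by an arbitrary linear subspace of dimension
  \<open>d\<close> of a Euclidean space: \<open>UNIV\<close> if \<open>d = DIM('a)\<close>, and \<open>{0}\<close> if \<open>d = 0\<close>. Such a subspace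
  is closed, so closedness, convexity and affine dimension of its subsets agree with the
  ambient notions.
\<close>

definition euclidean_d_space :: "nat \<Rightarrow> 'a::euclidean_space set \<Rightarrow> bool" where
  "euclidean_d_space d S \<longleftrightarrow> subspace S \<and> dim S = d"

end

theory Submission
  imports Defs
begin

text \<open>
  Put \<open>n = d - k\<close>. To a family \<open>J\<close> assign the flat \<open>p + W\<close>, where \<open>p\<close> is the point of
  \<open>\<Inter>J\<close> nearest to the origin and \<open>W\<close> is the intersection of the lineality spaces of the
  members of \<open>J\<close>. If \<open>\<Inter>H\<close> contains a \<open>k\<close>-flat, some \<open>n\<close>-element \<open>J \<subseteq> H\<close> has the same flat as \<open>H\<close>:
  a minimal \<open>J\<close> with the correct \<open>p\<close> has, by Radon's theorem modulo \<open>W\<close>, at most \<open>d - dim W\<close>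
  members, and each further member can be chosen to decrease \<open>dim W\<close>. By pigeonhole some
  \<open>n\<close>-element \<open>J\<close> serves at least \<open>\<alpha> (N - n) / (n + 1)\<close> of the \<open>(n + 1)\<close>-element
  families \<open>H\<close>, where \<open>N = |F|\<close>, and \<open>G\<close> is the union of these.
\<close>

section \<open>Lineality spaces and the canonical flat of a family\<close>

definition lineality :: "'a::real_vector set \<Rightarrow> 'a set" where
  "lineality C = {v. \<forall>x\<in>C. \<forall>t. x + t *\<^sub>R v \<in> C}"

text \<open>The factor \<open>S\<close> gives the empty family the direction space \<open>S\<close>;
  this case occurs for \<open>d = k\<close>, where the chosen subfamily is empty.\<close>

definition directions :: "'a::real_vector set \<Rightarrow> 'a set set \<Rightarrow> 'a set" where
  "directions S H = S \<inter> (\<Inter>C\<in>H. lineality C)"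

definition core_point :: "'a::euclidean_space set \<Rightarrow> 'a set set \<Rightarrow> 'a" where
  "core_point S H = closest_point (S \<inter> \<Inter>H) 0"

definition core :: "'a::euclidean_space set \<Rightarrow> 'a set set \<Rightarrow> 'a set" where
  "core S H = (+) (core_point S H) ` directions S H"

lemma subspace_lineality: "subspace (lineality C)"
  unfolding subspace_def lineality_def
  by (auto simp: scaleR_add_right simp flip: add.assoc)

lemma lineality_add: "v \<in> lineality C \<Longrightarrow> x \<in> C \<Longrightarrow> x + v \<in> C"
  unfolding lineality_def by (metis (mono_tags, lifting) mem_Collect_eq scaleR_one)

lemma lineality_diff: "v \<in> lineality C \<Longrightarrow> x \<in> C \<Longrightarrow> x - v \<in> C"
  using lineality_add[of "- v" C x] subspace_neg[OF subspace_lineality] by auto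

lemma subspace_directions: "subspace S \<Longrightarrow> subspace (directions S H)"
  unfolding directions_def
  by (intro subspace_inter subspace_Inter) (auto simp: subspace_lineality)

lemma directions_insert: "directions S (insert C H) = directions S H \<inter> lineality C"
  unfolding directions_def by auto

lemma directions_antimono: "J \<subseteq> H \<Longrightarrow> directions S H \<subseteq> directions S J"
  unfolding directions_def by auto

text \<open>Segments from \<open>x\<close> to points ever farther out on the given line approach the
  line through \<open>x\<close> with direction \<open>v\<close>. Convexity puts them in
  \<open>C\<close>, and closedness keeps the limit there.\<close>

lemma line_direction_in_lineality:
  fixes C :: "'a::real_normed_vector set"
  assumes "closed C" "convex C" and line: "\<And>t. p + t *\<^sub>R v \<in> C"
  shows "v \<in> lineality C"
  unfolding lineality_def
proof (intro CollectI ballI allI)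
  fix x t assume x: "x \<in> C"
  \<comment> \<open>The weight \<open>1 / Suc n\<close> cancels the factor \<open>Suc n\<close> of
    the parameter, so the contribution along \<open>v\<close> stays \<open>t *\<^sub>R v\<close>
    while the rest tends to \<open>x\<close>.\<close>
  define u where "u n = (1 - 1 / real (Suc n)) *\<^sub>R x
      + (1 / real (Suc n)) *\<^sub>R (p + (real (Suc n) * t) *\<^sub>R v)" for n
  have "u n \<in> C" for n
    unfolding u_def by (rule convexD[OF \<open>convex C\<close> x line]) (auto simp: field_simps)
  moreover have "u = (\<lambda>n. x + t *\<^sub>R v + (1 / real (Suc n)) *\<^sub>R (p - x))"
    unfolding u_def by (simp add: scaleR_add_right scaleR_diff_right scaleR_diff_left algebra_simps del: of_nat_Suc)
  moreover have "(\<lambda>n. x + t *\<^sub>R v + (1 / real (Suc n)) *\<^sub>R (p - x))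
      \<longlonglongrightarrow> x + t *\<^sub>R v + 0 *\<^sub>R (p - x)"
    by (intro tendsto_intros LIMSEQ_Suc[OF lim_1_over_n])
  ultimately show "x + t *\<^sub>R v \<in> C"
    using closed_sequentially[OF \<open>closed C\<close>, of u "x + t *\<^sub>R v"]
    by (simp del: of_nat_Suc flip: fun_eq_iff)
qed

text \<open>The direction space of a flat in \<open>\<Inter>H\<close> lies in every lineality space,
  so the flat can be translated to the nearest point. This trades an arbitrary flat for a canonical
  one that can be compared between families.\<close>

lemma contains_kflat_imp_core:
  fixes S :: "'a::euclidean_space set"
  assumes S: "subspace S" and H: "H \<noteq> {}"
    and C: "\<And>C. C \<in> H \<Longrightarrow> C \<subseteq> S \<and> closed C \<and> convex C"
    and flat: "contains_kflat k (\<Inter>H)"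
  shows "k \<le> dim (directions S H)" and "contains_kflat k (core S H)"
    and "core S H \<subseteq> \<Inter>H" and "S \<inter> \<Inter>H \<noteq> {}"
proof -
  obtain A where A: "affine A" "aff_dim A = int k" "A \<subseteq> \<Inter>H"
    using flat unfolding contains_kflat_def kflat_def by auto
  then have "A \<noteq> {}" by auto
  then obtain a where a: "a \<in> A" by auto
  define V where "V = (\<lambda>x. x - a) ` A"
  have V: "subspace V"
    unfolding V_def using A a by (simp add: affine_diffs_subspace_subtract)
  have "aff_dim V = int k"
    unfolding V_def by (simp add: aff_dim_translation_eq_subtract A)
  then have dV: "dim V = k"
    using V by (simp add: aff_dim_subspace)
  have AV: "a + v \<in> A" if "v \<in> V" for v
    using that unfolding V_def by auto
  have "V \<subseteq> lineality X" if "X \<in> H" for X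
  proof
    fix v assume "v \<in> V"
    then have "a + t *\<^sub>R v \<in> X" for t
      using AV[of "t *\<^sub>R v"] V A(3) that by (auto simp: subspace_scale)
    then show "v \<in> lineality X"
      using line_direction_in_lineality C[OF that] by blast
  qed
  moreover have "A \<subseteq> S" using A(3) H C by blast
  then have "V \<subseteq> S"
    unfolding V_def using a S by (auto intro: subspace_diff)
  ultimately have VW: "V \<subseteq> directions S H"
    unfolding directions_def by auto
  show "k \<le> dim (directions S H)"
    using dim_subset[OF VW] dV by simp
  have "affine ((+) (core_point S H) ` V)" "aff_dim ((+) (core_point S H) ` V) = int k"
    using V dV by (simp_all add: affine_translation[symmetric] subspace_imp_affine
        aff_dim_translation_eq aff_dim_subspace)
  then show "contains_kflat k (core S H)"
    unfolding contains_kflat_def kflat_def core_def using VW by blast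
  show ne: "S \<inter> \<Inter>H \<noteq> {}"
    using a A(3) \<open>A \<subseteq> S\<close> by blast
  have "closed (S \<inter> \<Inter>H)"
    using C S by (auto intro: closed_Inter closed_subspace)
  then have "core_point S H \<in> S \<inter> \<Inter>H"
    unfolding core_point_def using ne by (rule closest_point_in_set)
  then show "core S H \<subseteq> \<Inter>H"
    unfolding core_def directions_def by (auto intro: lineality_add)
qed

section \<open>A Helly-type bound for families whose intersection misses a ball\<close>

text \<open>Removing the component along the common lineality directions keeps a point in every member
  of \<open>J\<close> and in every ball around the origin, so Radon's theorem is applied in the orthogonal
  complement of these directions within \<open>S\<close>.\<close>

lemma Helly_ball_minimal:
  fixes S :: "'a::euclidean_space set"
  assumes S: "subspace S" and fin: "finite J"
    and conv: "\<And>C. C \<in> J \<Longrightarrow> convex C"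
    and ne: "S \<inter> \<Inter>J \<noteq> {}"
    and empty: "S \<inter> \<Inter>J \<inter> ball 0 r = {}"
    and minimal: "\<And>C. C \<in> J \<Longrightarrow> S \<inter> \<Inter>(J - {C}) \<inter> ball 0 r \<noteq> {}"
  shows "card J + dim (directions S J) \<le> dim S"
proof (rule ccontr)
  assume big: "\<not> ?thesis"
  define W where "W = directions S J"
  have W: "subspace W" "W \<subseteq> S" "\<And>C. C \<in> J \<Longrightarrow> W \<subseteq> lineality C"
    using subspace_directions[OF S] by (auto simp: W_def directions_def)
  define U where "U = {y \<in> S. \<forall>x\<in>W. orthogonal x y}"
  have dU: "dim U + dim W = dim S"
    unfolding U_def by (rule dim_subspace_orthogonal_to_vectors[OF W(1) S W(2)])
  have proj: "\<exists>y\<in>U \<inter> \<Inter>K. norm y \<le> norm x" if "K \<subseteq> J" "x \<in> S \<inter> \<Inter>K" for K x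
  proof -
    obtain w y where wy: "w \<in> span W" "\<And>z. z \<in> span W \<Longrightarrow> orthogonal y z" "x = w + y"
      using orthogonal_subspace_decomp_exists[of W x] by blast
    have span: "span W = W" using W(1) by (simp add: span_eq_iff)
    have y: "y = x - w" using wy(3) by simp
    have "y \<in> S" unfolding y using that W wy(1) S span by (auto intro: subspace_diff)
    moreover have "orthogonal z y" if "z \<in> W" for z
      using wy(2)[of z] that unfolding span orthogonal_commute[of z y] .
    moreover have "y \<in> \<Inter>K"
      unfolding y using that W(3) wy(1) span by (blast intro: lineality_diff)
    moreover have "(norm x)\<^sup>2 = (norm w)\<^sup>2 + (norm y)\<^sup>2"
      unfolding wy(3) using wy(1,2) by (intro norm_add_Pythagorean) (simp add: orthogonal_commute)
    then have "norm y \<le> norm x" by (simp add: power2_le_imp_le)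
    ultimately show ?thesis unfolding U_def by blast
  qed
  obtain y0 where y0: "y0 \<in> U" "y0 \<in> \<Inter>J"
    using ne proj[of J] by blast
  have "\<exists>y\<in>U. y \<in> \<Inter>(J - {C}) \<and> y \<in> ball 0 r" if C: "C \<in> J" for C
  proof -
    obtain x where x: "x \<in> S \<inter> \<Inter>(J - {C})" "norm x < r"
      using minimal[OF C] by (auto simp: ball_def)
    have "J - {C} \<subseteq> J" by blast
    then obtain y where "y \<in> U \<inter> \<Inter>(J - {C})" "norm y \<le> norm x"
      using proj x(1) by blast
    then show ?thesis using x(2) by auto
  qed
  then obtain f where f: "\<And>C. C \<in> J \<Longrightarrow> f C \<in> U"
      "\<And>C. C \<in> J \<Longrightarrow> f C \<in> \<Inter>(J - {C})" "\<And>C. C \<in> J \<Longrightarrow> f C \<in> ball 0 r"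
    by metis
  have US: "U \<subseteq> S" by (auto simp: U_def)
  have nf: "f C \<notin> C" if "C \<in> J" for C
  proof
    assume "f C \<in> C"
    then have "f C \<in> S \<inter> \<Inter>J \<inter> ball 0 r" using f[OF that] US by auto
    then show False using empty by simp
  qed
  have inj: "inj_on f J"
  proof (rule inj_onI, rule ccontr)
    fix C D assume "C \<in> J" "D \<in> J" "f C = f D" "C \<noteq> D"
    then have "f C \<in> C" using f(2)[of D] by auto
    then show False using nf \<open>C \<in> J\<close> by blast
  qed
  have y0f: "y0 \<notin> f ` J" using nf y0(2) by auto
  have sub: "insert y0 (f ` J) \<subseteq> U" using f(1) y0(1) by auto
  have "card (insert y0 (f ` J)) = Suc (card J)"
    using fin y0f by (simp add: card_image[OF inj])
  moreover have "dim (insert y0 (f ` J)) \<le> dim U"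
    using sub by (rule dim_subset)
  \<comment> \<open>The negated bound and \<open>dU\<close> give \<open>dim U < card J\<close>, so
    these \<open>card J + 1\<close> points number at least \<open>dim U + 2\<close>.\<close>
  ultimately have "affine_dependent (insert y0 (f ` J))"
    using big dU fin by (intro affine_dependent_biggerset_general) (auto simp: W_def)
  then obtain M P where MP: "M \<subseteq> insert y0 (f ` J)" "P \<subseteq> insert y0 (f ` J)" "M \<inter> P = {}"
      "convex hull M \<inter> convex hull P \<noteq> {}"
    by (rule Radon)
  then obtain z where zM: "z \<in> convex hull M" and zP: "z \<in> convex hull P" by blast
  \<comment> \<open>The Radon classes are disjoint, so one of them avoids \<open>c\<close>: a convex
    set may miss one of the points and still contain \<open>z\<close>. The exception is
    \<open>f C\<close> for a member \<open>C\<close>, and \<open>y0\<close> for the ball.\<close>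
  have hull: "z \<in> X" if "convex X" "c \<in> insert y0 (f ` J)" "insert y0 (f ` J) - {c} \<subseteq> X" for X c
  proof -
    have "c \<notin> M \<or> c \<notin> P" using MP(3) by blast
    then have "M \<subseteq> insert y0 (f ` J) - {c} \<or> P \<subseteq> insert y0 (f ` J) - {c}"
      using MP(1,2) by (simp add: subset_Diff_insert)
    then have "M \<subseteq> X \<or> P \<subseteq> X" using that(3) by (metis subset_trans)
    then show ?thesis
      using zM zP hull_minimal[of M X convex] hull_minimal[of P X convex] that(1) by (elim disjE) auto
  qed
  have "z \<in> C" if "C \<in> J" for C
    using that f(2) y0(2) by (intro hull[of C "f C"] conv) auto
  moreover have "z \<in> ball 0 r"
    using f(3) by (intro hull[of "ball 0 r" y0]) auto
  moreover have "z \<in> convex hull insert y0 (f ` J)"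
    using zM MP(1) hull_mono by blast
  then have "z \<in> S"
    using hull_minimal[of "insert y0 (f ` J)" S convex] sub US subspace_imp_convex[OF S] by blast
  ultimately show False using empty by blast
qed

text \<open>Members are discarded as long as the ball is still missed; the induction ends at a
  family minimal in this respect, where \<open>Helly_ball_minimal\<close> applies.\<close>

lemma Helly_ball:
  fixes S :: "'a::euclidean_space set"
  assumes S: "subspace S" and fin: "finite H"
    and conv: "\<And>C. C \<in> H \<Longrightarrow> convex C"
    and ne: "S \<inter> \<Inter>H \<noteq> {}"
    and empty: "S \<inter> \<Inter>H \<inter> ball 0 r = {}"
  shows "\<exists>J\<subseteq>H. S \<inter> \<Inter>J \<inter> ball 0 r = {} \<and> card J + dim (directions S J) \<le> dim S"
  using fin conv ne empty
proof (induction H rule: finite_psubset_induct)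
  case (psubset H)
  show ?case
  proof (cases "\<exists>C\<in>H. S \<inter> \<Inter>(H - {C}) \<inter> ball 0 r = {}")
    case True
    then obtain C where C: "C \<in> H" "S \<inter> \<Inter>(H - {C}) \<inter> ball 0 r = {}" by blast
    moreover have "S \<inter> \<Inter>(H - {C}) \<noteq> {}" using psubset.prems(2) by blast
    moreover have "H - {C} \<subset> H" using C(1) by blast
    ultimately obtain J where "J \<subseteq> H - {C}" "S \<inter> \<Inter>J \<inter> ball 0 r = {}"
        "card J + dim (directions S J) \<le> dim S"
      using psubset.IH[of "H - {C}"] psubset.prems(1) by auto
    then show ?thesis by blast
  next
    case False
    then have "card H + dim (directions S H) \<le> dim S"
      using psubset.prems psubset.hyps S by (intro Helly_ball_minimal) auto
    then show ?thesis using psubset.prems(3) by blast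
  qed
qed

section \<open>Small subfamilies with the same core\<close>

text \<open>A member of \<open>K\<close> is taken only if it strictly shrinks the direction space.
  The drop in dimension pays for the added member, so cardinality plus dimension never
  grows.\<close>

lemma directions_extend:
  fixes S :: "'a::euclidean_space set"
  assumes S: "subspace S" and "finite J" "finite K"
  shows "\<exists>K'\<subseteq>K. directions S (J \<union> K') = directions S (J \<union> K) \<and>
    card (J \<union> K') + dim (directions S (J \<union> K')) \<le> card J + dim (directions S J)"
  using \<open>finite K\<close>
proof (induction K rule: finite_induct)
  case empty
  then show ?case by simp
next
  case (insert C K)
  then obtain K' where K': "K' \<subseteq> K" "directions S (J \<union> K') = directions S (J \<union> K)"
      "card (J \<union> K') + dim (directions S (J \<union> K')) \<le> card J + dim (directions S J)"
    by auto
  define W where "W = directions S (J \<union> K)"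
  show ?case
  proof (cases "W \<subseteq> lineality C")
    case True
    then have "directions S (J \<union> insert C K) = W"
      unfolding W_def by (auto simp: directions_insert)
    then show ?thesis using K' unfolding W_def by blast
  next
    case False
    have "subspace (W \<inter> lineality C)" "subspace W"
      unfolding W_def by (simp_all add: subspace_inter subspace_lineality subspace_directions[OF S])
    moreover have "W \<inter> lineality C \<subset> W" using False by blast
    ultimately have "dim (W \<inter> lineality C) < dim W"
      by (intro dim_psubset) (simp add: span_eq_iff[THEN iffD2])
    moreover have "directions S (J \<union> insert C K') = W \<inter> lineality C"
        "directions S (J \<union> insert C K) = W \<inter> lineality C"
      using K'(2) by (simp_all add: directions_insert W_def)
    moreover have "card (J \<union> insert C K') \<le> Suc (card (J \<union> K'))"
      by (simp add: card_insert_if finite_subset[OF K'(1) insert.hyps(1)] \<open>finite J\<close>)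
    ultimately show ?thesis
      using K' by (intro exI[of _ "insert C K'"]) (auto simp: W_def)
  qed
qed

text \<open>\<open>Helly_ball\<close> yields members that fix the nearest point,
  \<open>directions_extend\<close> adds members that fix the directions, and arbitrary members of
  \<open>H\<close> fill up to \<open>n\<close>. There is room because the direction space has
  dimension at least \<open>k\<close>, which limits the first two groups to \<open>dim S - k\<close>
  members.\<close>

lemma core_subfamily:
  fixes S :: "'a::euclidean_space set"
  assumes S: "subspace S" and H: "H \<noteq> {}" "finite H"
    and C: "\<And>C. C \<in> H \<Longrightarrow> C \<subseteq> S \<and> closed C \<and> convex C"
    and flat: "contains_kflat k (\<Inter>H)"
    and n: "dim S - k \<le> n" "n \<le> card H"
  shows "\<exists>J\<subseteq>H. card J = n \<and> core S J = core S H"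
proof -
  note core = contains_kflat_imp_core[OF S H(1) C flat]
  define p where "p = core_point S H"
  have closed: "closed (S \<inter> \<Inter>J)" and convex: "convex (S \<inter> \<Inter>J)" if "J \<subseteq> H" for J
    using C S that by (auto intro!: closed_Int closed_Inter convex_Int convex_Inter
        intro: closed_subspace subspace_imp_convex)
  have p: "p \<in> S \<inter> \<Inter>H"
    unfolding p_def core_point_def using closed core(4) by (intro closest_point_in_set) auto
  have "norm p \<le> norm z" if "z \<in> S \<inter> \<Inter>H" for z
    using closest_point_le[OF closed[OF subset_refl] that, of 0]
    by (simp add: p_def core_point_def)
  \<comment> \<open>The radius is the least norm on the intersection; a subfamily that still misses
    this open ball cannot have a point nearer than \<open>p\<close>.\<close>
  then have "S \<inter> \<Inter>H \<inter> ball 0 (norm p) = {}" by fastforce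
  then obtain J where J: "J \<subseteq> H" "S \<inter> \<Inter>J \<inter> ball 0 (norm p) = {}"
      "card J + dim (directions S J) \<le> dim S"
    using Helly_ball[OF S H(2) _ core(4)] C by meson
  have finJ: "finite J" using J(1) H(2) by (rule finite_subset)
  obtain K where K: "K \<subseteq> H" "directions S (J \<union> K) = directions S (J \<union> H)"
      "card (J \<union> K) + dim (directions S (J \<union> K)) \<le> card J + dim (directions S J)"
    using directions_extend[OF S finJ H(2)] by blast
  have JH: "J \<union> H = H" using J(1) by blast
  have "card (J \<union> K) \<le> n" using K J(3) n(1) core(1) JH by simp
  \<comment> \<open>Any family between \<open>J \<union> K\<close> and \<open>H\<close> will do: its
    directions are squeezed between equal spaces, and its intersection misses the ball because that
    of \<open>J\<close> does.\<close>
  then obtain L where L: "J \<union> K \<subseteq> L" "L \<subseteq> H" "card L = n"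
    using exists_subset_between[of "J \<union> K" n H] n(2) J(1) K(1) H(2) by blast
  have "directions S L = directions S H"
    using directions_antimono[OF L(1), of S] directions_antimono[OF L(2), of S] K(2) JH by auto
  moreover have "p = core_point S L"
    unfolding core_point_def
  proof (rule closest_point_unique[OF convex[OF L(2)] closed[OF L(2)]])
    show "p \<in> S \<inter> \<Inter>L" using p L(2) by auto
    show "\<forall>z\<in>S \<inter> \<Inter>L. dist 0 p \<le> dist 0 z"
    proof
      fix z assume "z \<in> S \<inter> \<Inter>L"
      then have "z \<in> S \<inter> \<Inter>J" using L(1) by blast
      then have "z \<notin> ball 0 (norm p)" using J(2) by blast
      then show "dist 0 p \<le> dist 0 z" by simp
    qed
  qed
  ultimately have "core S L = core S H"
    unfolding core_def p_def by simp
  then show ?thesis using L(2,3) by blast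
qed

section \<open>Pigeonhole and counting\<close>

lemma Suc_choose_ratio: "Suc n * (N choose Suc n) = (N - n) * (N choose n)"
  by (simp only: binomial_absorption binomial_absorb_comp)

text \<open>With \<open>N = card F\<close>, averaging over the \<open>n\<close>-element sets gives a
  \<open>J\<close> shared by at least \<open>\<alpha> * (N - n) / (n + 1)\<close> members of
  \<open>A\<close>. Each of them is \<open>J\<close> with one element of its own, so their union has
  at least \<open>n\<close> more elements than there are such members.\<close>

lemma popular_subfamily:
  fixes g :: "'a set \<Rightarrow> 'a set" and \<alpha> :: real
  assumes F: "finite F" "n < card F" and \<alpha>: "0 < \<alpha>" "\<alpha> \<le> 1"
    and sub: "\<And>H. H \<in> A \<Longrightarrow> H \<subseteq> F \<and> card H = Suc n"
    and g: "\<And>H. H \<in> A \<Longrightarrow> g H \<subseteq> H \<and> card (g H) = n"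
    and many: "real (card A) \<ge> \<alpha> * real (card F choose Suc n)"
  shows "\<exists>J. \<exists>B\<subseteq>A. B \<noteq> {} \<and> (\<forall>H\<in>B. g H = J) \<and>
    real (card (\<Union>B)) \<ge> \<alpha> / real (Suc n) * real (card F)"
proof -
  define N where "N = card F"
  define T where "T = {J. J \<subseteq> F \<and> card J = n}"
  have cT: "card T = N choose n" unfolding T_def N_def using F(1) by (rule n_subsets)
  have finT: "finite T" unfolding T_def using F(1) by simp
  have finA: "finite A" using sub F(1) by (intro finite_subset[of A "Pow F"]) auto
  have "N choose n > 0" using F(2) by (simp add: N_def)
  then have "T \<noteq> {}" using cT by auto
  moreover have "g \<in> A \<rightarrow> T" using g sub unfolding T_def by blast
  ultimately obtain J where J: "J \<in> T" "card (g -` {J} \<inter> A) * card T \<ge> card A"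
    using pigeonhole_card finA finT by metis
  define B where "B = g -` {J} \<inter> A"
  have finB: "finite B" using finA by (simp add: B_def)
  \<comment> \<open>The absorption identity expresses both binomials through
    \<open>N choose n\<close>, which then cancels.\<close>
  have "\<alpha> * real (N - n) * real (N choose n) = \<alpha> * real (N choose Suc n) * real (Suc n)"
    using arg_cong[OF Suc_choose_ratio[of n N], of real]
    by (simp only: of_nat_mult mult_ac)
  also have "\<dots> \<le> real (card A) * real (Suc n)"
    using many by (intro mult_right_mono) (auto simp: N_def)
  also have "\<dots> \<le> real (card B * (N choose n)) * real (Suc n)"
    using J(2) cT by (intro mult_right_mono of_nat_mono) (auto simp: B_def)
  finally have "(\<alpha> * real (N - n)) * real (N choose n)
      \<le> (real (card B) * real (Suc n)) * real (N choose n)"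
    by (simp add: mult_ac)
  then have cB: "\<alpha> * real (N - n) \<le> real (card B) * real (Suc n)"
    using \<open>N choose n > 0\<close> by (subst (asm) mult_le_cancel_right_pos) auto
  moreover have "\<alpha> * real (N - n) > 0" using \<alpha>(1) F(2) by (simp add: N_def)
  ultimately have "card B \<noteq> 0" by (metis less_le_not_le mult_zero_left of_nat_0)
  then have "B \<noteq> {}" by auto
  have finU: "finite (\<Union>B)"
    using sub F(1) by (intro finite_subset[of "\<Union>B" F]) (auto simp: B_def)
  have JB: "J \<subseteq> H" "card H = Suc n" "finite H" if "H \<in> B" for H
    using that g[of H] sub[of H] F(1) by (auto simp: B_def intro: finite_subset)
  have finJ: "finite J" "card J = n" using J(1) F(1) by (auto simp: T_def intro: finite_subset)
  have "\<exists>x. H = insert x J \<and> x \<notin> J" if "H \<in> B" for H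
  proof -
    have "card (H - J) = 1" using JB[OF that] finJ by (simp add: card_Diff_subset)
    then obtain x where "H - J = {x}" by (auto simp: card_1_singleton_iff)
    then show ?thesis using JB(1)[OF that] by blast
  qed
  then obtain e where e: "\<And>H. H \<in> B \<Longrightarrow> H = insert (e H) J" "\<And>H. H \<in> B \<Longrightarrow> e H \<notin> J"
    by metis
  have "inj_on e B" by (metis e(1) inj_onI)
  then have "card (e ` B) = card B" by (rule card_image)
  moreover have "card (J \<union> e ` B) = card J + card (e ` B)"
    using finJ finB e(2) by (intro card_Un_disjoint) auto
  moreover have "J \<union> e ` B \<subseteq> \<Union>B" using e(1) \<open>B \<noteq> {}\<close> by blast
  then have "card (J \<union> e ` B) \<le> card (\<Union>B)" by (rule card_mono[OF finU])
  ultimately have cU: "n + card B \<le> card (\<Union>B)" using finJ(2) by simp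
  have "\<alpha> * real N = \<alpha> * real (N - n) + \<alpha> * real n"
    using F(2) by (simp add: N_def of_nat_diff algebra_simps)
  \<comment> \<open>The second summand uses \<open>\<alpha> \<le> 1 \<le> Suc n\<close>: the
    elements of \<open>J\<close> make up for the missing \<open>\<alpha> * n\<close>.\<close>
  also have "\<dots> \<le> real (card B) * real (Suc n) + real n * real (Suc n)"
    using cB \<alpha> by (intro add_mono) (auto intro: mult_mono simp: mult.commute[of \<alpha>])
  also have "\<dots> = real (n + card B) * real (Suc n)" by (simp add: algebra_simps)
  also have "\<dots> \<le> real (card (\<Union>B)) * real (Suc n)"
    using cU by (intro mult_right_mono of_nat_mono) auto
  finally have "\<alpha> / real (Suc n) * real (card F) \<le> real (card (\<Union>B))"
    by (simp add: N_def field_simps del: of_nat_Suc)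
  then show ?thesis using \<open>B \<noteq> {}\<close> by (intro exI[of _ J] exI[of _ B]) (auto simp: B_def)
qed

theorem theorem5:
  fixes k d :: nat and \<alpha> :: real
  assumes "k \<le> d" and "0 < \<alpha>" and "\<alpha> \<le> 1"
  shows "\<exists>\<beta>::real. \<beta> > 0 \<and> \<beta> \<ge> \<alpha> / real (d - k + 1) \<and>
    (\<forall>S::'a::euclidean_space set. euclidean_d_space d S \<longrightarrow>
      (\<forall>F::'a set set.
        finite F \<and> card F \<ge> d - k + 1 \<and>
        (\<forall>C\<in>F. C \<subseteq> S \<and> closed C \<and> convex C) \<and>
        real (card {H. H \<subseteq> F \<and> card H = d - k + 1 \<and> contains_kflat k (\<Inter>H)})
          \<ge> \<alpha> * real (card F choose (d - k + 1)) \<longrightarrow>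
        (\<exists>G\<subseteq>F. real (card G) \<ge> \<beta> * real (card F) \<and> contains_kflat k (\<Inter>G))))"
proof (intro exI[of _ "\<alpha> / real (d - k + 1)"] conjI allI impI)
  show "0 < \<alpha> / real (d - k + 1)" using assms(2) by simp
  show "\<alpha> / real (d - k + 1) \<le> \<alpha> / real (d - k + 1)" by simp
next
  fix S :: "'a set" and F :: "'a set set"
  assume "euclidean_d_space d S"
  then have S: "subspace S" "dim S = d" by (auto simp: euclidean_d_space_def)
  define n where "n = d - k"
  define A where "A = {H. H \<subseteq> F \<and> card H = Suc n \<and> contains_kflat k (\<Inter>H)}"
  assume "finite F \<and> card F \<ge> d - k + 1 \<and>
        (\<forall>C\<in>F. C \<subseteq> S \<and> closed C \<and> convex C) \<and>
        real (card {H. H \<subseteq> F \<and> card H = d - k + 1 \<and> contains_kflat k (\<Inter>H)})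
          \<ge> \<alpha> * real (card F choose (d - k + 1))"
  then have F: "finite F" "n < card F" "\<And>C. C \<in> F \<Longrightarrow> C \<subseteq> S \<and> closed C \<and> convex C"
      "real (card A) \<ge> \<alpha> * real (card F choose Suc n)"
    by (auto simp: n_def A_def)
  have A: "H \<noteq> {}" "finite H" "H \<subseteq> F" "card H = Suc n" "contains_kflat k (\<Inter>H)"
      "\<And>C. C \<in> H \<Longrightarrow> C \<subseteq> S \<and> closed C \<and> convex C" if "H \<in> A" for H
    using that F(1,3) by (auto simp: A_def intro: finite_subset)
  have "\<exists>J\<subseteq>H. card J = n \<and> core S J = core S H" if "H \<in> A" for H
    using A[OF that] S by (intro core_subfamily[where k = k]) (auto simp: n_def)
  then obtain g where g: "\<And>H. H \<in> A \<Longrightarrow> g H \<subseteq> H \<and> card (g H) = n"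
      "\<And>H. H \<in> A \<Longrightarrow> core S (g H) = core S H"
    by metis
  obtain J B where B: "B \<subseteq> A" "B \<noteq> {}" "\<And>H. H \<in> B \<Longrightarrow> g H = J"
      "real (card (\<Union>B)) \<ge> \<alpha> / real (Suc n) * real (card F)"
    using popular_subfamily[OF F(1,2) assms(2,3) _ g(1) F(4)] A(3,4) by metis
  have core: "core S H = core S J" if "H \<in> B" for H
    using g(2) B(1,3) that by (metis subsetD)
  have kflat: "contains_kflat k (core S H)" "core S H \<subseteq> \<Inter>H" if "H \<in> A" for H
    using contains_kflat_imp_core(2,3)[OF S(1) A(1)[OF that] A(6)[OF that] A(5)[OF that]] by auto
  have flat: "contains_kflat k (core S J)" "core S J \<subseteq> \<Inter>H" if "H \<in> B" for H
    using kflat[of H] core[OF that] that B(1) by auto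
  \<comment> \<open>The common core lies in every \<open>H\<close> of \<open>B\<close>, hence in
    every member of the union; that it contains a flat is read off from any \<open>H\<close> of the
    nonempty \<open>B\<close>.\<close>
  then have "contains_kflat k (core S J)" "core S J \<subseteq> \<Inter>(\<Union>B)"
    using B(2) by blast+
  then have "contains_kflat k (\<Inter>(\<Union>B))"
    unfolding contains_kflat_def by blast
  moreover have "\<Union>B \<subseteq> F" using A(3) B(1) by blast
  ultimately show "\<exists>G\<subseteq>F. real (card G) \<ge> \<alpha> / real (d - k + 1) * real (card F)
      \<and> contains_kflat k (\<Inter>G)"
    using B(4) by (intro exI[of _ "\<Union>B"]) (simp add: n_def)
qed

end
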